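(* Let $S$ be an almost integral semiring. The following are equivalent: (i) $\mathbf{M}_n(S)$ is congruence-simple for some $n\geq 2$. (ii) $S$ is congruence-simple and $|SS|\geq 2$. (iii) $S(+,\cdot)\cong L_2(\vee,\wedge)$, where $L_2$ is the two-element lattice. Moreover, if $S$ is congruence-simple then $|S|=2$.
   Context: A semiring $S(+,\cdot)$ is a non-empty set with two associative binary operations such that $+$ is commutative and $\cdot$ distributes over $+$ from both sides (no zero or unity is required). It is additively idempotent if $a+a=a$ for all $a\in S$; then $S$ is ordered by $a\leq b$ iff $a+b=b$. $S$ is almost integral if it is additively idempotent and $ab\leq a$ and $ba\leq a$ for all $a,b\in S$. $SS=\{ab : a,b\in S\}$. A congruence on $S$ is an equivalence relation preserved under addition and multiplication. $S$ is congruence-simple if it has exactly two congruences. $\mathbf{M}_n(S)$ is the semiring of all $n\times n$ matrices over $S$ with the usual addition and multiplication: $(a_{ij})+(b_{ij})=(a_{ij}+b_{ij})$, $(a_{ij})(b_{ij})=(\sum_k a_{ik}b_{kj})$. $L_2(\vee,\wedge)$ is regarded as a semiring with addition $\vee$ and multiplication $\wedge$. *)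

theory Defs
  imports "HOL-Algebra.Congruence"
begin

(* The semirings considered here need neither a zero nor a unity.  The library's class "semiring"
   has these axioms, but the matrix size n is quantified inside the theorem, so the semirings of
   n x n matrices have to live on explicit carriers rather than on types. *)

record 'a semiring_struct = "'a partial_object" +
  add :: "'a \<Rightarrow> 'a \<Rightarrow> 'a" (infixl "\<oplus>\<index>" 65)
  mult :: "'a \<Rightarrow> 'a \<Rightarrow> 'a" (infixl "\<otimes>\<index>" 70)

locale carrier_semiring =
  fixes S :: "('a, 'm) semiring_struct_scheme" (structure)
  assumes nonempty: "carrier S \<noteq> {}"
    and add_closed: "\<lbrakk>a \<in> carrier S; b \<in> carrier S\<rbrakk> \<Longrightarrow> a \<oplus> b \<in> carrier S"
    and mult_closed: "\<lbrakk>a \<in> carrier S; b \<in> carrier S\<rbrakk> \<Longrightarrow> a \<otimes> b \<in> carrier S"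
    and add_assoc:
      "\<lbrakk>a \<in> carrier S; b \<in> carrier S; c \<in> carrier S\<rbrakk> \<Longrightarrow> (a \<oplus> b) \<oplus> c = a \<oplus> (b \<oplus> c)"
    and add_commute: "\<lbrakk>a \<in> carrier S; b \<in> carrier S\<rbrakk> \<Longrightarrow> a \<oplus> b = b \<oplus> a"
    and mult_assoc:
      "\<lbrakk>a \<in> carrier S; b \<in> carrier S; c \<in> carrier S\<rbrakk> \<Longrightarrow> (a \<otimes> b) \<otimes> c = a \<otimes> (b \<otimes> c)"
    and distrib_left:
      "\<lbrakk>a \<in> carrier S; b \<in> carrier S; c \<in> carrier S\<rbrakk> \<Longrightarrow> a \<otimes> (b \<oplus> c) = (a \<otimes> b) \<oplus> (a \<otimes> c)"
    and distrib_right: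
      "\<lbrakk>a \<in> carrier S; b \<in> carrier S; c \<in> carrier S\<rbrakk> \<Longrightarrow> (a \<oplus> b) \<otimes> c = (a \<otimes> c) \<oplus> (b \<otimes> c)"

locale additively_idempotent_semiring = carrier_semiring +
  assumes add_idem: "a \<in> carrier S \<Longrightarrow> a \<oplus> a = a"

definition add_le :: "('a, 'm) semiring_struct_scheme \<Rightarrow> 'a \<Rightarrow> 'a \<Rightarrow> bool"
    ("(_/ \<sqsubseteq>\<index> _)" [51, 51] 50) where
  "a \<sqsubseteq>\<^bsub>S\<^esub> b \<longleftrightarrow> a \<oplus>\<^bsub>S\<^esub> b = b"

locale almost_integral_semiring = additively_idempotent_semiring +
  assumes mult_le_left: "\<lbrakk>a \<in> carrier S; b \<in> carrier S\<rbrakk> \<Longrightarrow> a \<otimes> b \<sqsubseteq> a"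
    and mult_le_right: "\<lbrakk>a \<in> carrier S; b \<in> carrier S\<rbrakk> \<Longrightarrow> b \<otimes> a \<sqsubseteq> a"

definition products :: "('a, 'm) semiring_struct_scheme \<Rightarrow> 'a set" where
  "products S = {a \<otimes>\<^bsub>S\<^esub> b | a b. a \<in> carrier S \<and> b \<in> carrier S}"

definition semiring_congruence ::
    "('a, 'm) semiring_struct_scheme \<Rightarrow> ('a \<times> 'a) set \<Rightarrow> bool" where
  "semiring_congruence S r \<longleftrightarrow>
     equiv (carrier S) r \<and>
     (\<forall>a b c d. (a, b) \<in> r \<and> (c, d) \<in> r \<longrightarrow>
        (a \<oplus>\<^bsub>S\<^esub> c, b \<oplus>\<^bsub>S\<^esub> d) \<in> r \<and> (a \<otimes>\<^bsub>S\<^esub> c, b \<otimes>\<^bsub>S\<^esub> d) \<in> r)"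

definition congruence_simple :: "('a, 'm) semiring_struct_scheme \<Rightarrow> bool" where
  "congruence_simple S \<longleftrightarrow> card {r. semiring_congruence S r} = 2"

(* f 0 + ... + f m: without a zero only non-empty sums make sense, so the upper bound is included. *)
primrec sum_upto :: "('a, 'm) semiring_struct_scheme \<Rightarrow> (nat \<Rightarrow> 'a) \<Rightarrow> nat \<Rightarrow> 'a" where
  "sum_upto S f 0 = f 0"
| "sum_upto S f (Suc m) = sum_upto S f m \<oplus>\<^bsub>S\<^esub> f (Suc m)"

(* Indices run over {0..<n}.  Matrices are extensional functions, so that equality of matrices is
   equality of all n * n entries.  Only n > 0 is meaningful. *)
definition matrix_semiring ::
    "nat \<Rightarrow> ('a, 'm) semiring_struct_scheme \<Rightarrow> (nat \<times> nat \<Rightarrow> 'a) semiring_struct" where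
  "matrix_semiring n S =
     \<lparr>carrier = {..<n} \<times> {..<n} \<rightarrow>\<^sub>E carrier S,
      add = (\<lambda>A B. \<lambda>(i, j)\<in>{..<n} \<times> {..<n}. A (i, j) \<oplus>\<^bsub>S\<^esub> B (i, j)),
      mult = (\<lambda>A B. \<lambda>(i, j)\<in>{..<n} \<times> {..<n}.
                sum_upto S (\<lambda>k. A (i, k) \<otimes>\<^bsub>S\<^esub> B (k, j)) (n - 1))\<rparr>"

definition semiring_isomorphic ::
    "('a, 'm) semiring_struct_scheme \<Rightarrow> ('b, 'k) semiring_struct_scheme \<Rightarrow> bool" where
  "semiring_isomorphic S T \<longleftrightarrow>
     (\<exists>h. bij_betw h (carrier S) (carrier T) \<and>
        (\<forall>a\<in>carrier S. \<forall>b\<in>carrier S.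
           h (a \<oplus>\<^bsub>S\<^esub> b) = h a \<oplus>\<^bsub>T\<^esub> h b \<and> h (a \<otimes>\<^bsub>S\<^esub> b) = h a \<otimes>\<^bsub>T\<^esub> h b))"

(* The two-element lattice, as the lattice of truth values with False below True. *)
definition L2 :: "bool semiring_struct" where
  "L2 = \<lparr>carrier = UNIV, add = (\<or>), mult = (\<and>)\<rparr>"

end

theory Submission
  imports Defs
begin

text \<open>
  In an almost integral semiring \<open>x + a = y + a\<close> defines a congruence for every \<open>a\<close>: multiplying
  by \<open>z\<close> turns \<open>a\<close> into \<open>az \<le> a\<close>, which adding \<open>a\<close> absorbs. If the semiring is
  congruence-simple, then \<open>a\<close> is the least element (identity relation) or the greatest one (full
  relation), whence \<open>|S| = 2\<close>, and the multiplication is either constant or that of \<open>L\<^sub>2\<close>.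
  Congruences of \<open>S\<close> act entrywise on matrices, so \<open>S\<close> is simple if \<open>M\<^sub>n(S)\<close> is. If the
  multiplication of \<open>S\<close> is constant, then \<open>M\<^sub>n(S)\<close> is itself almost integral with more than two
  elements, hence not simple. Conversely, a nontrivial congruence of \<open>M\<^sub>2(L\<^sub>2)\<close> identifies
  the zero matrix with the diagonal matrix units, hence with the unit matrix, hence with everything.
\<close>

section \<open>Congruences and congruence-simplicity on explicit carriers\<close>

lemma semiring_congruenceI:
  fixes S (structure)
  assumes "r \<subseteq> carrier S \<times> carrier S"
    and "\<And>a. a \<in> carrier S \<Longrightarrow> (a, a) \<in> r"
    and "\<And>a b. (a, b) \<in> r \<Longrightarrow> (b, a) \<in> r"
    and "\<And>a b c. (a, b) \<in> r \<Longrightarrow> (b, c) \<in> r \<Longrightarrow> (a, c) \<in> r"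
    and "\<And>a b c d. (a, b) \<in> r \<Longrightarrow> (c, d) \<in> r \<Longrightarrow> (a \<oplus> c, b \<oplus> d) \<in> r"
    and "\<And>a b c d. (a, b) \<in> r \<Longrightarrow> (c, d) \<in> r \<Longrightarrow> (a \<otimes> c, b \<otimes> d) \<in> r"
  shows "semiring_congruence S r"
  unfolding semiring_congruence_def
  by (intro conjI equivI refl_onI symI transI allI impI; (elim conjE)?; rule assms; assumption)

lemma semiring_congruenceD:
  fixes S (structure)
  assumes "semiring_congruence S r"
  shows semiring_congruence_subset: "r \<subseteq> carrier S \<times> carrier S"
    and semiring_congruence_refl: "\<And>a. a \<in> carrier S \<Longrightarrow> (a, a) \<in> r"
    and semiring_congruence_sym: "\<And>a b. (a, b) \<in> r \<Longrightarrow> (b, a) \<in> r"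
    and semiring_congruence_trans: "\<And>a b c. (a, b) \<in> r \<Longrightarrow> (b, c) \<in> r \<Longrightarrow> (a, c) \<in> r"
    and semiring_congruence_add:
      "\<And>a b c d. (a, b) \<in> r \<Longrightarrow> (c, d) \<in> r \<Longrightarrow> (a \<oplus> c, b \<oplus> d) \<in> r"
    and semiring_congruence_mult:
      "\<And>a b c d. (a, b) \<in> r \<Longrightarrow> (c, d) \<in> r \<Longrightarrow> (a \<otimes> c, b \<otimes> d) \<in> r"
  using assms unfolding semiring_congruence_def equiv_def
  by (auto dest: refl_onD symD transD)

text \<open>The identity and the full relation are always congruences and bound all others, so
  exactly two congruences means that these two differ and that there are no more. Only closure of
  the operations is assumed, so that the criterion also covers matrices, whose other semiring axioms
  are proved below only for constant multiplication.\<close>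

lemma congruence_simple_iff:
  fixes S (structure)
  assumes add: "\<And>a b. \<lbrakk>a \<in> carrier S; b \<in> carrier S\<rbrakk> \<Longrightarrow> a \<oplus> b \<in> carrier S"
    and mult: "\<And>a b. \<lbrakk>a \<in> carrier S; b \<in> carrier S\<rbrakk> \<Longrightarrow> a \<otimes> b \<in> carrier S"
  shows "congruence_simple S \<longleftrightarrow>
    (\<exists>a\<in>carrier S. \<exists>b\<in>carrier S. a \<noteq> b) \<and>
    (\<forall>r. semiring_congruence S r \<longrightarrow> r = Id_on (carrier S) \<or> r = carrier S \<times> carrier S)"
    (is "_ \<longleftrightarrow> ?nontrivial \<and> ?simple")
proof -
  let ?C = "{r. semiring_congruence S r}"
  have Id: "Id_on (carrier S) \<in> ?C" and full: "carrier S \<times> carrier S \<in> ?C"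
    by (auto intro!: semiring_congruenceI simp: add mult)
  have between: "Id_on (carrier S) \<subseteq> r \<and> r \<subseteq> carrier S \<times> carrier S"
    if "semiring_congruence S r" for r
    using semiring_congruence_subset[OF that] semiring_congruence_refl[OF that] by auto
  have nontrivial_iff: "?nontrivial \<longleftrightarrow> Id_on (carrier S) \<noteq> carrier S \<times> carrier S"
    unfolding Id_on_def by fast
  show ?thesis
  proof
    assume "congruence_simple S"
    then obtain r s where rs: "?C = {r, s}" "r \<noteq> s"
      unfolding congruence_simple_def card_2_iff by blast
    have ne: "Id_on (carrier S) \<noteq> carrier S \<times> carrier S"
    proof
      assume "Id_on (carrier S) = carrier S \<times> carrier S"
      then have "t = carrier S \<times> carrier S" if "t \<in> ?C" for t
        using between[of t] that by auto
      then show False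
        using rs by (metis insertI1 insertI2)
    qed
    have "Id_on (carrier S) \<in> {r, s}" "carrier S \<times> carrier S \<in> {r, s}"
      using Id full unfolding rs(1) .
    then have "?C = {Id_on (carrier S), carrier S \<times> carrier S}"
      unfolding rs(1) using ne by auto
    then have "t = Id_on (carrier S) \<or> t = carrier S \<times> carrier S" if "semiring_congruence S t" for t
      using that by (metis insertE mem_Collect_eq singletonD)
    then show "?nontrivial \<and> ?simple"
      unfolding nontrivial_iff using ne by simp
  next
    assume *: "?nontrivial \<and> ?simple"
    then have "?C = {Id_on (carrier S), carrier S \<times> carrier S}"
      using Id full by blast
    then show "congruence_simple S"
      using * unfolding congruence_simple_def nontrivial_iff card_2_iff by blast
  qed
qed

lemma (in carrier_semiring) carrier_congruence_simple_iff:
  "congruence_simple S \<longleftrightarrow>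
    (\<exists>a\<in>carrier S. \<exists>b\<in>carrier S. a \<noteq> b) \<and>
    (\<forall>r. semiring_congruence S r \<longrightarrow> r = Id_on (carrier S) \<or> r = carrier S \<times> carrier S)"
  by (intro congruence_simple_iff add_closed mult_closed)

section \<open>Congruence-simple almost integral semirings\<close>

context almost_integral_semiring
begin

text \<open>The relation is the kernel of the map that adds \<open>a\<close>. For products the two
  factors are replaced one at a time, each by means of an absorption law.\<close>

lemma add_eq_congruence:
  assumes a: "a \<in> carrier S"
  shows "semiring_congruence S
    {(x, y). x \<in> carrier S \<and> y \<in> carrier S \<and> x \<oplus> a = y \<oplus> a}" (is "semiring_congruence S ?r")
proof (rule semiring_congruenceI)
  \<comment> \<open>Distributivity yields the extra summand \<open>a \<otimes> z\<close>, which lies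
    below \<open>a\<close> and disappears in the final sum with \<open>a\<close>.\<close>
  have absorb_right: "(x \<oplus> a) \<otimes> z \<oplus> a = x \<otimes> z \<oplus> a"
    if "x \<in> carrier S" "z \<in> carrier S" for x z
    using that a mult_le_left[OF a that(2)]
    by (simp add: distrib_right add_assoc mult_closed add_le_def)
  have absorb_left: "z \<otimes> (x \<oplus> a) \<oplus> a = z \<otimes> x \<oplus> a"
    if "x \<in> carrier S" "z \<in> carrier S" for x z
    using that a mult_le_right[OF a that(2)]
    by (simp add: distrib_left add_assoc mult_closed add_le_def)
  fix x y u v
  assume "(x, y) \<in> ?r" "(u, v) \<in> ?r"
  then have c: "x \<in> carrier S" "y \<in> carrier S" "u \<in> carrier S" "v \<in> carrier S"
    and xy: "x \<oplus> a = y \<oplus> a" and uv: "u \<oplus> a = v \<oplus> a" by auto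
  have "x \<oplus> u \<oplus> a = x \<oplus> (v \<oplus> a)"
    using c a by (simp add: add_assoc uv)
  also have "\<dots> = (x \<oplus> a) \<oplus> v"
    using c a by (simp add: add_assoc add_commute[of a v])
  also have "\<dots> = y \<oplus> v \<oplus> a"
    using c a unfolding xy by (simp add: add_assoc add_commute[of a v])
  finally show "(x \<oplus> u, y \<oplus> v) \<in> ?r"
    using c by (auto simp: add_closed)
  have "x \<otimes> u \<oplus> a = y \<otimes> u \<oplus> a"
    using absorb_right c xy by metis
  also have "\<dots> = y \<otimes> v \<oplus> a"
    using absorb_left c uv by metis
  finally show "(x \<otimes> u, y \<otimes> v) \<in> ?r"
    using c by (auto simp: mult_closed)
qed auto

lemma congruence_simple_least_or_greatest:
  assumes "congruence_simple S" and a: "a \<in> carrier S"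
  shows "(\<forall>x\<in>carrier S. a \<sqsubseteq> x) \<or> (\<forall>x\<in>carrier S. x \<sqsubseteq> a)"
proof -
  let ?r = "{(x, y). x \<in> carrier S \<and> y \<in> carrier S \<and> x \<oplus> a = y \<oplus> a}"
  consider "?r = Id_on (carrier S)" | "?r = carrier S \<times> carrier S"
    using assms(1) add_eq_congruence[OF a] unfolding carrier_congruence_simple_iff by meson
  then show ?thesis
  proof cases
    case 1
    have "a \<sqsubseteq> x" if x: "x \<in> carrier S" for x
    proof -
      \<comment> \<open>Adding \<open>a\<close> once more changes nothing on the left, by
        idempotence, so this pair is always related.\<close>
      have "(x \<oplus> a, x) \<in> ?r"
        using a x by (simp add: add_assoc add_closed add_idem)
      then have "x \<oplus> a = x"
        unfolding 1 by auto
      then show ?thesis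
        using a x by (simp add: add_le_def add_commute)
    qed
    then show ?thesis by blast
  next
    case 2
    have "x \<sqsubseteq> a" if x: "x \<in> carrier S" for x
    proof -
      have "(x, a) \<in> ?r"
        unfolding 2 using a x by simp
      then show ?thesis
        using a by (simp add: add_le_def add_idem)
    qed
    then show ?thesis by blast
  qed
qed

lemma add_le_antisym:
  "\<lbrakk>a \<in> carrier S; b \<in> carrier S; a \<sqsubseteq> b; b \<sqsubseteq> a\<rbrakk> \<Longrightarrow> a = b"
  unfolding add_le_def using add_commute by metis

lemma congruence_simple_two_elements:
  assumes "congruence_simple S"
  obtains z e where "carrier S = {z, e}" "z \<noteq> e" "z \<sqsubseteq> e"
proof -
  obtain a b where ab: "a \<in> carrier S" "b \<in> carrier S" "a \<noteq> b"
    using assms carrier_congruence_simple_iff by blast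
  \<comment> \<open>Pigeonhole: of the three elements \<open>a\<close>, \<open>b\<close>,
    \<open>x\<close>, two are both least or both greatest, hence equal by antisymmetry.\<close>
  have "x = a \<or> x = b" if "x \<in> carrier S" for x
    using congruence_simple_least_or_greatest[OF assms] add_le_antisym ab that by metis
  then have "carrier S = {a, b}"
    using ab by blast
  moreover have "a \<sqsubseteq> b \<or> b \<sqsubseteq> a"
    using congruence_simple_least_or_greatest[OF assms ab(1)] ab(2) by blast
  ultimately show thesis
    using that[of a b] that[of b a] ab(3) by auto
qed

lemma card_congruence_simple: "congruence_simple S \<Longrightarrow> card (carrier S) = 2"
  by (erule congruence_simple_two_elements) simp

text \<open>A product with factor \<open>z\<close> lies below \<open>z\<close> by almost
  integrality, and nothing but \<open>z\<close> lies below \<open>z\<close>.\<close>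

lemma two_element_zero:
  assumes S: "carrier S = {z, e}" "z \<noteq> e" "z \<sqsubseteq> e" and x: "x \<in> carrier S"
  shows "z \<oplus> x = x" "x \<oplus> z = x" "z \<otimes> x = z" "x \<otimes> z = z"
proof -
  have z: "z \<in> carrier S"
    using S(1) by simp
  show add: "z \<oplus> x = x" "x \<oplus> z = x"
    using S x z add_commute[OF x z] by (auto simp: add_le_def add_idem)
  have below_z: "y = z" if "y \<in> carrier S" "y \<sqsubseteq> z" for y
    using that S z add_commute[OF that(1) z] by (auto simp: add_le_def)
  show "z \<otimes> x = z" "x \<otimes> z = z"
    using mult_closed mult_le_left mult_le_right x z by (auto intro!: below_z)
qed

text \<open>With two comparable elements, idempotence and \<open>two_element_zero\<close> fix every
  sum and every product except \<open>e \<otimes> e\<close>. That single product decides between the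
  lattice and constant multiplication.\<close>

lemma isomorphic_L2_iff:
  "semiring_isomorphic S L2 \<longleftrightarrow>
    (\<exists>z e. carrier S = {z, e} \<and> z \<noteq> e \<and> z \<sqsubseteq> e \<and> e \<otimes> e = e)"
proof
  assume "semiring_isomorphic S L2"
  then obtain h where bij: "bij_betw h (carrier S) (UNIV :: bool set)"
    and hom: "\<And>a b. \<lbrakk>a \<in> carrier S; b \<in> carrier S\<rbrakk> \<Longrightarrow>
      h (a \<oplus> b) = (h a \<or> h b) \<and> h (a \<otimes> b) = (h a \<and> h b)"
    unfolding semiring_isomorphic_def L2_def by auto
  obtain z e where ze: "z \<in> carrier S" "e \<in> carrier S" "\<not> h z" "h e"
    using bij unfolding bij_betw_def by (metis (full_types) UNIV_I imageE)
  have inj: "a = b" if "a \<in> carrier S" "b \<in> carrier S" "h a = h b" for a b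
    using bij that unfolding bij_betw_def inj_on_def by blast
  have "carrier S = {z, e}"
    using inj ze by auto
  moreover have "z \<oplus> e = e" "e \<otimes> e = e"
    using ze by (auto intro!: inj simp: add_closed mult_closed hom)
  ultimately show "\<exists>z e. carrier S = {z, e} \<and> z \<noteq> e \<and> z \<sqsubseteq> e \<and> e \<otimes> e = e"
    using ze unfolding add_le_def by blast
next
  assume "\<exists>z e. carrier S = {z, e} \<and> z \<noteq> e \<and> z \<sqsubseteq> e \<and> e \<otimes> e = e"
  then obtain z e where ze: "carrier S = {z, e}" "z \<noteq> e" "z \<sqsubseteq> e" "e \<otimes> e = e"
    by blast
  show "semiring_isomorphic S L2"
    unfolding semiring_isomorphic_def L2_def
    using ze two_element_zero[OF ze(1-3)] add_idem
    by (intro exI[of _ "\<lambda>x. x = e"]) (auto simp: bij_betw_def)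
qed

end

section \<open>Matrices and entrywise congruences\<close>

lemma carrier_matrix_semiring:
  "carrier (matrix_semiring n S) = {..<n} \<times> {..<n} \<rightarrow>\<^sub>E carrier S"
  by (simp add: matrix_semiring_def)

lemma matrix_add_apply [simp]:
  "i < n \<Longrightarrow> j < n \<Longrightarrow>
    (A \<oplus>\<^bsub>matrix_semiring n S\<^esub> B) (i, j) = A (i, j) \<oplus>\<^bsub>S\<^esub> B (i, j)"
  by (simp add: matrix_semiring_def)

lemma matrix_mult_apply [simp]:
  "i < n \<Longrightarrow> j < n \<Longrightarrow>
    (A \<otimes>\<^bsub>matrix_semiring n S\<^esub> B) (i, j) =
      sum_upto S (\<lambda>k. A (i, k) \<otimes>\<^bsub>S\<^esub> B (k, j)) (n - 1)"
  by (simp add: matrix_semiring_def)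

lemma matrix_entry_closed:
  "\<lbrakk>A \<in> carrier (matrix_semiring n S); i < n; j < n\<rbrakk> \<Longrightarrow> A (i, j) \<in> carrier S"
  by (auto simp: carrier_matrix_semiring)

lemma matrix_eqI:
  assumes "A \<in> carrier (matrix_semiring n S)" "B \<in> carrier (matrix_semiring n S)"
    and "\<And>i j. i < n \<Longrightarrow> j < n \<Longrightarrow> A (i, j) = B (i, j)"
  shows "A = B"
  using assms by (intro PiE_ext[of A _ _ B]) (auto simp: carrier_matrix_semiring)

text \<open>One induction serves three instances of \<open>R\<close>: membership in the carrier,
  equality, and a congruence of \<open>S\<close>.\<close>

lemma sum_upto_related:
  assumes "\<And>a b c d. R a b \<Longrightarrow> R c d \<Longrightarrow> R (a \<oplus>\<^bsub>S\<^esub> c) (b \<oplus>\<^bsub>S\<^esub> d)"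
    and "\<And>k. k \<le> m \<Longrightarrow> R (f k) (g k)"
  shows "R (sum_upto S f m) (sum_upto S g m)"
  using assms(2) by (induction m) (auto intro!: assms(1))

context carrier_semiring
begin

lemma sum_upto_closed:
  "(\<And>k. k \<le> m \<Longrightarrow> f k \<in> carrier S) \<Longrightarrow> sum_upto S f m \<in> carrier S"
  by (rule sum_upto_related[where R = "\<lambda>a _. a \<in> carrier S"]) (auto simp: add_closed)

lemma matrix_add_closed:
  "\<lbrakk>A \<in> carrier (matrix_semiring n S); B \<in> carrier (matrix_semiring n S)\<rbrakk> \<Longrightarrow>
    A \<oplus>\<^bsub>matrix_semiring n S\<^esub> B \<in> carrier (matrix_semiring n S)"
  by (auto simp: matrix_semiring_def intro!: add_closed)

lemma matrix_mult_closed: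
  assumes "A \<in> carrier (matrix_semiring n S)" "B \<in> carrier (matrix_semiring n S)"
  shows "A \<otimes>\<^bsub>matrix_semiring n S\<^esub> B \<in> carrier (matrix_semiring n S)"
proof -
  \<comment> \<open>The bound \<open>i < n\<close> forces \<open>n\<close> to be positive, so every
    index up to \<open>n - 1\<close> really is below \<open>n\<close>.\<close>
  have "sum_upto S (\<lambda>k. A (i, k) \<otimes> B (k, j)) (n - 1) \<in> carrier S" if "i < n" "j < n" for i j
    using that by (intro sum_upto_closed mult_closed assms[THEN matrix_entry_closed]) auto
  then show ?thesis
    by (auto simp: matrix_semiring_def)
qed

lemma matrix_congruence_simple_iff:
  fixes n
  defines "M \<equiv> matrix_semiring n S"
  shows "congruence_simple M \<longleftrightarrow>
    (\<exists>A\<in>carrier M. \<exists>B\<in>carrier M. A \<noteq> B) \<and>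
    (\<forall>r. semiring_congruence M r \<longrightarrow> r = Id_on (carrier M) \<or> r = carrier M \<times> carrier M)"
  unfolding M_def by (intro congruence_simple_iff matrix_add_closed matrix_mult_closed)

definition entrywise :: "nat \<Rightarrow> ('a \<times> 'a) set \<Rightarrow> ((nat \<times> nat \<Rightarrow> 'a) \<times> (nat \<times> nat \<Rightarrow> 'a)) set"
  where "entrywise n r =
    {(A, B). A \<in> carrier (matrix_semiring n S) \<and> B \<in> carrier (matrix_semiring n S) \<and>
      (\<forall>i<n. \<forall>j<n. (A (i, j), B (i, j)) \<in> r)}"

lemma entrywise_congruence:
  assumes r: "semiring_congruence S r"
  shows "semiring_congruence (matrix_semiring n S) (entrywise n r)"
proof (rule semiring_congruenceI)
  show "(A, A) \<in> entrywise n r" if "A \<in> carrier (matrix_semiring n S)" for A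
    using that semiring_congruence_refl[OF r] matrix_entry_closed[OF that]
    unfolding entrywise_def by blast
  show "(B, A) \<in> entrywise n r" if "(A, B) \<in> entrywise n r" for A B
    using that semiring_congruence_sym[OF r] unfolding entrywise_def by blast
  show "(A, C) \<in> entrywise n r" if "(A, B) \<in> entrywise n r" "(B, C) \<in> entrywise n r" for A B C
    using that semiring_congruence_trans[OF r] unfolding entrywise_def by blast
  fix A B C D assume *: "(A, B) \<in> entrywise n r" "(C, D) \<in> entrywise n r"
  then have carriers: "A \<in> carrier (matrix_semiring n S)" "B \<in> carrier (matrix_semiring n S)"
    "C \<in> carrier (matrix_semiring n S)" "D \<in> carrier (matrix_semiring n S)"
    and related: "\<And>i j. i < n \<Longrightarrow> j < n \<Longrightarrow> (A (i, j), B (i, j)) \<in> r"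
    "\<And>i j. i < n \<Longrightarrow> j < n \<Longrightarrow> (C (i, j), D (i, j)) \<in> r"
    unfolding entrywise_def by blast+
  show "(A \<oplus>\<^bsub>matrix_semiring n S\<^esub> C, B \<oplus>\<^bsub>matrix_semiring n S\<^esub> D) \<in> entrywise n r"
    using matrix_add_closed[OF carriers(1,3)] matrix_add_closed[OF carriers(2,4)]
    unfolding entrywise_def by (simp add: related semiring_congruence_add[OF r])
  have "(sum_upto S (\<lambda>k. A (i, k) \<otimes> C (k, j)) (n - 1),
         sum_upto S (\<lambda>k. B (i, k) \<otimes> D (k, j)) (n - 1)) \<in> r" if "i < n" "j < n" for i j
    using that by (intro sum_upto_related[where R = "\<lambda>a b. (a, b) \<in> r"]
        semiring_congruence_add[OF r] semiring_congruence_mult[OF r] related) auto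
  then show "(A \<otimes>\<^bsub>matrix_semiring n S\<^esub> C, B \<otimes>\<^bsub>matrix_semiring n S\<^esub> D) \<in> entrywise n r"
    using matrix_mult_closed[OF carriers(1,3)] matrix_mult_closed[OF carriers(2,4)]
    unfolding entrywise_def by simp
qed (auto simp: entrywise_def)

text \<open>Constant matrices embed the set \<open>S\<close> into the matrices, and a congruence
  \<open>r\<close> is recovered from its entrywise lift by restriction to them. Hence
  \<open>r\<close> is the identity or full as soon as its lift is. Constant matrices are available
  even when \<open>S\<close> has no zero or unity.\<close>

lemma congruence_simple_if_matrix:
  assumes "congruence_simple (matrix_semiring n S)" and "n \<noteq> 0"
  shows "congruence_simple S"
proof -
  let ?M = "matrix_semiring n S"
  define const where "const a = (\<lambda>p\<in>{..<n} \<times> {..<n}. a)" for a :: 'a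
  have const_in: "const a \<in> carrier ?M" if "a \<in> carrier S" for a
    using that by (auto simp: const_def carrier_matrix_semiring)
  have const_eq: "const a = const b \<longleftrightarrow> a = b" for a b
    using \<open>n \<noteq> 0\<close> by (auto simp: const_def fun_eq_iff)
  have related: "(const a, const b) \<in> entrywise n r \<longleftrightarrow> (a, b) \<in> r"
    if "a \<in> carrier S" "b \<in> carrier S" for a b r
    using const_in[OF that(1)] const_in[OF that(2)] \<open>n \<noteq> 0\<close>
    by (auto simp: entrywise_def const_def)
  have "r = Id_on (carrier S) \<or> r = carrier S \<times> carrier S" if r: "semiring_congruence S r" for r
  proof -
    note in_carrier = semiring_congruence_subset[OF r]
    consider "entrywise n r = Id_on (carrier ?M)" | "entrywise n r = carrier ?M \<times> carrier ?M"
      using entrywise_congruence[OF r] assms(1) matrix_congruence_simple_iff by blast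
    then show ?thesis
    proof cases
      case 1
      have "a = b" if ab: "(a, b) \<in> r" for a b
      proof -
        have "(const a, const b) \<in> entrywise n r"
          using ab in_carrier by (subst related) auto
        then show ?thesis
          unfolding 1 by (auto simp: const_eq)
      qed
      then have "r = Id_on (carrier S)"
        using in_carrier semiring_congruence_refl[OF r] by auto
      then show ?thesis ..
    next
      case 2
      have "(a, b) \<in> r" if "a \<in> carrier S" "b \<in> carrier S" for a b
        using related[OF that, of r] const_in[OF that(1)] const_in[OF that(2)] unfolding 2 by blast
      then show ?thesis
        using in_carrier by auto
    qed
  qed
  moreover have "\<exists>a\<in>carrier S. \<exists>b\<in>carrier S. a \<noteq> b"
  proof -
    obtain A B where "A \<in> carrier ?M" "B \<in> carrier ?M" "A \<noteq> B"
      using assms(1) matrix_congruence_simple_iff by blast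
    then show ?thesis
      using matrix_eqI[of A n S B] matrix_entry_closed[of _ n S] by metis
  qed
  ultimately show ?thesis
    unfolding carrier_congruence_simple_iff by blast
qed

end

section \<open>Matrices over constant multiplication and over the two-element lattice\<close>

context almost_integral_semiring
begin

lemma sum_upto_const: "a \<in> carrier S \<Longrightarrow> sum_upto S (\<lambda>_. a) m = a"
  by (induction m) (simp_all add: add_idem)

text \<open>Every entry of a matrix product is a sum of copies of \<open>z\<close>, which
  idempotence collapses to \<open>z\<close>. So matrix multiplication is constant too, and its value
  \<open>Z\<close> is neutral for addition, which makes the axioms involving multiplication
  immediate.\<close>

lemma matrix_almost_integral_if_const_mult:
  assumes const: "\<And>a b. \<lbrakk>a \<in> carrier S; b \<in> carrier S\<rbrakk> \<Longrightarrow> a \<otimes> b = z"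
  shows "almost_integral_semiring (matrix_semiring n S)"
proof -
  let ?M = "matrix_semiring n S"
  obtain a where a: "a \<in> carrier S"
    using nonempty by blast
  have z: "z \<in> carrier S"
    using mult_closed[OF a a] const[OF a a] by simp
  \<comment> \<open>The constant \<open>z\<close> equals \<open>x \<otimes> x\<close>, which lies
    below \<open>x\<close>.\<close>
  have z_le: "z \<oplus> x = x" "x \<oplus> z = x" if "x \<in> carrier S" for x
    using mult_le_left[OF that that] that z by (simp_all add: const add_le_def add_commute)
  define Z where "Z = (\<lambda>p\<in>{..<n} \<times> {..<n}. z)"
  have Z: "Z \<in> carrier ?M"
    using z by (auto simp: Z_def carrier_matrix_semiring)
  have mult: "A \<otimes>\<^bsub>?M\<^esub> B = Z" if "A \<in> carrier ?M" "B \<in> carrier ?M" for A B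
  proof (rule matrix_eqI[OF matrix_mult_closed[OF that] Z])
    fix i j assume ij: "i < n" "j < n"
    have "sum_upto S (\<lambda>k. A (i, k) \<otimes> B (k, j)) (n - 1) = sum_upto S (\<lambda>_. z) (n - 1)"
      using ij by (intro sum_upto_related[where R = "(=)"] const that[THEN matrix_entry_closed]) auto
    then show "(A \<otimes>\<^bsub>?M\<^esub> B) (i, j) = Z (i, j)"
      using ij z by (simp add: sum_upto_const Z_def)
  qed
  note entry = matrix_entry_closed[of _ n S]
  have Z_add: "Z \<oplus>\<^bsub>?M\<^esub> A = A" if "A \<in> carrier ?M" for A
    using that Z by (intro matrix_eqI[of _ n S] matrix_add_closed) (auto simp: Z_def z_le entry)
  show ?thesis
  proof
    show "carrier ?M \<noteq> {}"
      using Z by blast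
    fix A B C assume A: "A \<in> carrier ?M"
    show "A \<oplus>\<^bsub>?M\<^esub> A = A"
      using A by (intro matrix_eqI[of _ n S] matrix_add_closed) (auto simp: add_idem entry)
    assume B: "B \<in> carrier ?M"
    show "A \<oplus>\<^bsub>?M\<^esub> B \<in> carrier ?M" "A \<otimes>\<^bsub>?M\<^esub> B \<in> carrier ?M"
      using A B by (rule matrix_add_closed matrix_mult_closed)+
    show "A \<oplus>\<^bsub>?M\<^esub> B = B \<oplus>\<^bsub>?M\<^esub> A"
      using A B by (intro matrix_eqI[of _ n S] matrix_add_closed) (auto simp: entry add_commute)
    show "A \<otimes>\<^bsub>?M\<^esub> B \<sqsubseteq>\<^bsub>?M\<^esub> A" "B \<otimes>\<^bsub>?M\<^esub> A \<sqsubseteq>\<^bsub>?M\<^esub> A"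
      unfolding add_le_def mult[OF A B] mult[OF B A] by (rule Z_add[OF A])+
    assume C: "C \<in> carrier ?M"
    show "A \<oplus>\<^bsub>?M\<^esub> B \<oplus>\<^bsub>?M\<^esub> C = A \<oplus>\<^bsub>?M\<^esub> (B \<oplus>\<^bsub>?M\<^esub> C)"
      using A B C by (intro matrix_eqI[of _ n S] matrix_add_closed) (auto simp: entry add_assoc)
    show "A \<otimes>\<^bsub>?M\<^esub> B \<otimes>\<^bsub>?M\<^esub> C = A \<otimes>\<^bsub>?M\<^esub> (B \<otimes>\<^bsub>?M\<^esub> C)"
      using A B C Z by (simp only: mult)
    show "A \<otimes>\<^bsub>?M\<^esub> (B \<oplus>\<^bsub>?M\<^esub> C) = A \<otimes>\<^bsub>?M\<^esub> B \<oplus>\<^bsub>?M\<^esub> (A \<otimes>\<^bsub>?M\<^esub> C)"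
      "(A \<oplus>\<^bsub>?M\<^esub> B) \<otimes>\<^bsub>?M\<^esub> C = A \<otimes>\<^bsub>?M\<^esub> C \<oplus>\<^bsub>?M\<^esub> (B \<otimes>\<^bsub>?M\<^esub> C)"
      using A B C Z by (simp_all only: mult matrix_add_closed Z_add)
  qed
qed

text \<open>The cardinality result is used twice, for \<open>S\<close> and for its matrices. It
  gives \<open>2 ^ (n * n) = 2\<close>, which is impossible for \<open>n \<ge> 2\<close>.\<close>

lemma not_const_mult_if_matrix_simple:
  assumes simple: "congruence_simple (matrix_semiring n S)" and "n \<ge> 2"
    and const: "\<And>a b. \<lbrakk>a \<in> carrier S; b \<in> carrier S\<rbrakk> \<Longrightarrow> a \<otimes> b = z"
  shows False
proof -
  have "card (carrier S) = 2"
    using simple \<open>n \<ge> 2\<close> by (intro card_congruence_simple congruence_simple_if_matrix[of n]) auto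
  then have "card (carrier (matrix_semiring n S)) = 2 ^ (n * n)"
    by (simp add: carrier_matrix_semiring card_funcsetE)
  moreover have "card (carrier (matrix_semiring n S)) = 2"
    using almost_integral_semiring.card_congruence_simple[OF _ simple]
      matrix_almost_integral_if_const_mult[OF const] by blast
  ultimately have "(2::nat) ^ (n * n) = 2 ^ 1"
    by simp
  then have "n * n = 1"
    by (subst (asm) power_inject_exp) auto
  then show False
    using \<open>n \<ge> 2\<close> by simp
qed

text \<open>Here \<open>z\<close> acts as zero and \<open>e\<close> as unity, so matrix units are
  available. The size 2 suffices as a witness for condition (i).\<close>

lemma matrix_2_congruence_simple:
  assumes S: "carrier S = {z, e}" "z \<noteq> e" "z \<sqsubseteq> e" "e \<otimes> e = e"
  shows "congruence_simple (matrix_semiring 2 S)"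
  unfolding matrix_congruence_simple_iff
proof (intro conjI allI impI)
  let ?M = "matrix_semiring 2 S"
  note zero = two_element_zero[OF S(1-3)]
  have unit: "e \<otimes> x = x" "x \<otimes> e = x" if "x \<in> carrier S" for x
    using that S zero by auto
  have in_S: "z \<in> carrier S" "e \<in> carrier S"
    using S(1) by auto
  \<comment> \<open>These are the matrix units and the zero matrix over \<open>z\<close> and
    \<open>e\<close>.\<close>
  define E where "E k l = (\<lambda>p\<in>{..<2} \<times> {..<2}. if p = (k, l) then e else z)" for k l :: nat
  define Z where "Z = (\<lambda>p\<in>{..<2::nat} \<times> {..<2::nat}. z)"
  have E: "E k l \<in> carrier ?M" and Z: "Z \<in> carrier ?M" for k l
    using S(1) by (auto simp: E_def Z_def carrier_matrix_semiring)
  \<comment> \<open>For size 2 the last summation index is 1, so the sum has exactly two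
    terms.\<close>
  have mult_2: "(A \<otimes>\<^bsub>?M\<^esub> B) (p, q) = A (p, 0) \<otimes> B (0, q) \<oplus> A (p, 1) \<otimes> B (1, q)"
    if "p < 2" "q < 2" for A B p q
    using that by simp
  have cases_2: "k = 0 \<or> k = 1" if "k < 2" for k :: nat
    using that by auto
  note entry = matrix_entry_closed[of _ 2 S]
  \<comment> \<open>Left multiplication moves row \<open>i\<close> to row \<open>k\<close> and
    clears the rest; the right-hand version below does the same with columns \<open>j\<close> and
    \<open>k\<close>.\<close>
  have E_mult: "(E k i \<otimes>\<^bsub>?M\<^esub> A) (p, q) = (if p = k then A (i, q) else z)"
    if "A \<in> carrier ?M" "i < 2" "p < 2" "q < 2" for A i k p q
    using cases_2[OF that(2)] that(3,4) entry[OF that(1) _ that(4), of 0] entry[OF that(1) _ that(4), of 1]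
    by (auto simp: mult_2 E_def zero unit in_S simp del: matrix_mult_apply)
  have mult_E: "(A \<otimes>\<^bsub>?M\<^esub> E j k) (p, q) = (if q = k then A (p, j) else z)"
    if "A \<in> carrier ?M" "j < 2" "p < 2" "q < 2" for A j k p q
    using cases_2[OF that(2)] that(3,4) entry[OF that(1) that(3), of 0] entry[OF that(1) that(3), of 1]
    by (auto simp: mult_2 E_def zero unit in_S simp del: matrix_mult_apply)
  show "\<exists>A\<in>carrier ?M. \<exists>B\<in>carrier ?M. A \<noteq> B"
  proof (intro bexI)
    have "Z (0, 0) \<noteq> E 0 0 (0, 0)"
      using S(2) by (simp add: E_def Z_def)
    then show "Z \<noteq> E 0 0" by metis
  qed (rule E Z)+
  fix r assume r: "semiring_congruence ?M r"
  note in_carrier = semiring_congruence_subset[OF r]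
  note mult_r = semiring_congruence_mult[OF r]
  \<comment> \<open>Multiplying from both sides isolates the entry at \<open>(i, j)\<close> and
    moves it to the diagonal position \<open>(k, k)\<close>.\<close>
  have sandwich: "E k i \<otimes>\<^bsub>?M\<^esub> A \<otimes>\<^bsub>?M\<^esub> E j k = (if A (i, j) = e then E k k else Z)"
    if A: "A \<in> carrier ?M" and ij: "i < 2" "j < 2" for A i j k
  proof (rule matrix_eqI[of _ 2 S])
    show "E k i \<otimes>\<^bsub>?M\<^esub> A \<otimes>\<^bsub>?M\<^esub> E j k \<in> carrier ?M"
      by (intro matrix_mult_closed E A)
    fix p q :: nat assume pq: "p < 2" "q < 2"
    have "(E k i \<otimes>\<^bsub>?M\<^esub> A \<otimes>\<^bsub>?M\<^esub> E j k) (p, q) = (if p = k \<and> q = k then A (i, j) else z)"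
      using ij pq A by (simp add: mult_E E_mult matrix_mult_closed E del: matrix_mult_apply)
    then show "(E k i \<otimes>\<^bsub>?M\<^esub> A \<otimes>\<^bsub>?M\<^esub> E j k) (p, q) =
        (if A (i, j) = e then E k k else Z) (p, q)"
      using pq entry[OF A ij] S(1) by (auto simp: E_def Z_def simp del: matrix_mult_apply)
  qed (use E Z in simp)
  \<comment> \<open>One entry in which related matrices differ is enough. The order of
    \<open>z\<close> and \<open>e\<close> is fixed here; the opposite order follows by symmetry of
    \<open>r\<close>.\<close>
  have full: "r = carrier ?M \<times> carrier ?M"
    if AB: "(A, B) \<in> r" and ij: "i < 2" "j < 2" "A (i, j) = z" "B (i, j) = e" for A B i j
  proof -
    have Z_E: "(Z, E k k) \<in> r" if "k < 2" for k
    proof -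
      have "(E k i \<otimes>\<^bsub>?M\<^esub> A \<otimes>\<^bsub>?M\<^esub> E j k, E k i \<otimes>\<^bsub>?M\<^esub> B \<otimes>\<^bsub>?M\<^esub> E j k) \<in> r"
        using AB by (intro mult_r semiring_congruence_refl[OF r] E)
      moreover have "A \<in> carrier ?M" "B \<in> carrier ?M"
        using AB in_carrier by auto
      ultimately show ?thesis
        using that ij S(2) by (simp add: sandwich)
    qed
    \<comment> \<open>The right-hand sum is the unit matrix, the left-hand one is \<open>Z\<close>.
      Multiplying this pair by any \<open>C\<close> relates \<open>Z\<close> to
      \<open>C\<close>.\<close>
    have Z_I: "(Z \<oplus>\<^bsub>?M\<^esub> Z, E 0 0 \<oplus>\<^bsub>?M\<^esub> E 1 1) \<in> r"
      using Z_E by (intro semiring_congruence_add[OF r]) auto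
    have Z_C: "(Z, C) \<in> r" if C: "C \<in> carrier ?M" for C
    proof -
      have "((Z \<oplus>\<^bsub>?M\<^esub> Z) \<otimes>\<^bsub>?M\<^esub> C, (E 0 0 \<oplus>\<^bsub>?M\<^esub> E 1 1) \<otimes>\<^bsub>?M\<^esub> C) \<in> r"
        by (intro mult_r Z_I semiring_congruence_refl[OF r] C)
      moreover have "(Z \<oplus>\<^bsub>?M\<^esub> Z) \<otimes>\<^bsub>?M\<^esub> C = Z"
        by (intro matrix_eqI[of _ 2 S] matrix_mult_closed matrix_add_closed Z C)
          (simp add: mult_2 Z_def zero in_S entry[OF C] del: matrix_mult_apply)
      moreover have "(E 0 0 \<oplus>\<^bsub>?M\<^esub> E 1 1) \<otimes>\<^bsub>?M\<^esub> C = C"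
        by (intro matrix_eqI[of _ 2 S] matrix_mult_closed matrix_add_closed E C)
          (auto simp: mult_2 E_def zero unit in_S entry[OF C] simp del: matrix_mult_apply dest!: cases_2)
      ultimately show ?thesis by simp
    qed
    have "carrier ?M \<times> carrier ?M \<subseteq> r"
      using Z_C semiring_congruence_sym[OF r] semiring_congruence_trans[OF r] by blast
    then show ?thesis
      using in_carrier by blast
  qed
  show "r = Id_on (carrier ?M) \<or> r = carrier ?M \<times> carrier ?M"
  proof (cases "\<forall>(A, B)\<in>r. A = B")
    case True
    then have "r = Id_on (carrier ?M)"
      using in_carrier semiring_congruence_refl[OF r] by auto
    then show ?thesis ..
  next
    case False
    then obtain A B where AB: "(A, B) \<in> r" "A \<noteq> B" by auto
    then have carriers: "A \<in> carrier ?M" "B \<in> carrier ?M"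
      using in_carrier by auto
    then obtain i j where ij: "i < 2" "j < 2" "A (i, j) \<noteq> B (i, j)"
      using matrix_eqI[OF carriers] AB(2) by metis
    then consider "A (i, j) = z" "B (i, j) = e" | "B (i, j) = z" "A (i, j) = e"
      using entry[OF carriers(1) ij(1,2)] entry[OF carriers(2) ij(1,2)] S(1) by auto
    then have "r = carrier ?M \<times> carrier ?M"
    proof cases
      case 1
      then show ?thesis
        by (rule full[OF AB(1) ij(1,2)])
    next
      case 2
      then show ?thesis
        by (rule full[OF semiring_congruence_sym[OF r AB(1)] ij(1,2)])
    qed
    then show ?thesis ..
  qed
qed

end

section \<open>The set of products and the cycle of implications\<close>

text \<open>Since \<open>S\<close> is nonempty there is at least one product, so fewer than two
  means exactly one. The disjunct \<open>infinite\<close> is there because \<open>card\<close>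
  assigns 0 to infinite sets.\<close>

lemma (in carrier_semiring) two_products_iff:
  "(infinite (products S) \<or> card (products S) \<ge> 2) \<longleftrightarrow>
    \<not> (\<exists>z. \<forall>a\<in>carrier S. \<forall>b\<in>carrier S. a \<otimes> b = z)"
proof -
  obtain a where "a \<in> carrier S"
    using nonempty by blast
  then have ne: "products S \<noteq> {}"
    unfolding products_def by blast
  have "(\<forall>a\<in>carrier S. \<forall>b\<in>carrier S. a \<otimes> b = z) \<longleftrightarrow> products S \<subseteq> {z}" for z
    unfolding products_def by blast
  then have "(\<exists>z. \<forall>a\<in>carrier S. \<forall>b\<in>carrier S. a \<otimes> b = z) \<longleftrightarrow> (\<exists>z. products S = {z})"
    using ne by (simp add: subset_singleton_iff)
  also have "\<dots> \<longleftrightarrow> card (products S) = 1"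
    by (simp add: card_1_singleton_iff)
  also have "\<dots> \<longleftrightarrow> \<not> (infinite (products S) \<or> card (products S) \<ge> 2)"
  proof (cases "finite (products S)")
    case True
    then have "card (products S) \<noteq> 0"
      using ne by simp
    then have "card (products S) = 1 \<longleftrightarrow> \<not> card (products S) \<ge> 2"
      by linarith
    then show ?thesis
      using True by simp
  qed simp
  finally show ?thesis by simp
qed

theorem theorem4p6:
  fixes S :: "'a semiring_struct"
  assumes "almost_integral_semiring S"
  shows "((\<exists>n\<ge>2. congruence_simple (matrix_semiring n S)) \<longleftrightarrow>
            congruence_simple S \<and> (infinite (products S) \<or> card (products S) \<ge> 2))
       \<and> (congruence_simple S \<and> (infinite (products S) \<or> card (products S) \<ge> 2) \<longleftrightarrow>
            semiring_isomorphic S L2)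
       \<and> (congruence_simple S \<longrightarrow> card (carrier S) = 2)"
proof -
  interpret almost_integral_semiring S by fact
  have i_ii: "congruence_simple S \<and> (infinite (products S) \<or> card (products S) \<ge> 2)"
    if "n \<ge> 2" "congruence_simple (matrix_semiring n S)" for n
    using that congruence_simple_if_matrix[of n] not_const_mult_if_matrix_simple[of n]
    unfolding two_products_iff by fastforce
  have ii_iii: "semiring_isomorphic S L2"
    if simple: "congruence_simple S" and "infinite (products S) \<or> card (products S) \<ge> 2"
  proof -
    obtain z e where S: "carrier S = {z, e}" "z \<noteq> e" "z \<sqsubseteq>\<^bsub>S\<^esub> e"
      using congruence_simple_two_elements[OF simple] .
    \<comment> \<open>Otherwise all four products would equal \<open>z\<close>, against the presence
      of two products.\<close>
    have "e \<otimes>\<^bsub>S\<^esub> e \<noteq> z"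
    proof
      assume "e \<otimes>\<^bsub>S\<^esub> e = z"
      then have "\<forall>a\<in>carrier S. \<forall>b\<in>carrier S. a \<otimes>\<^bsub>S\<^esub> b = z"
        using S(1) two_element_zero[OF S] by auto
      then show False
        using that(2) two_products_iff by blast
    qed
    then have "e \<otimes>\<^bsub>S\<^esub> e = e"
      using mult_closed[of e e] S(1) by auto
    then show ?thesis
      using S isomorphic_L2_iff by blast
  qed
  \<comment> \<open>This closes the cycle from (i) through (ii) and (iii), with \<open>n = 2\<close>
    as the witness.\<close>
  have iii_i: "congruence_simple (matrix_semiring 2 S)" if "semiring_isomorphic S L2"
    using that matrix_2_congruence_simple isomorphic_L2_iff by blast
  show ?thesis
    using i_ii ii_iii iii_i card_congruence_simple by blast
qed

end
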